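(* Let $p\in[0,1]$ and $q=1-p$. If the server has probability $p$ of winning each point on his/her serve, then the probability $\theta_G(p)$ that the server wins the game is $$\theta_G(p)=p^4+4p^4q+10p^4q^2+20p^3q^3\,\theta_{GT}(p),$$ and $$\theta_G(1-p)=1-\theta_G(p).$$
   Context: Tennis game: one player (the server) serves all points. Point outcomes are independent, and the server wins each point with probability $p$ (otherwise the receiver wins it). The game ends, and is won by a player, as soon as that player has won at least 4 points and is ahead by at least 2 points. In particular, if the score reaches 3 points each (deuce), a game tie-breaker ensues in which the same player keeps serving and the first player to be ahead by two points wins. $\theta_{GT}(p)$ denotes the probability that the server wins the game tie-breaker (starting from the tied score); explicitly, $\theta_{GT}(p)=p^2/(p^2+q^2)$. *)

theory Defs
  imports "HOL-Probability.Probability"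
begin

text \<open>An outcome is an infinite stream of points, \<^term>\<open>True\<close> meaning that the server wins the
  point. Points after the end of the game are hypothetical and do not influence who wins it.\<close>

definition points :: "real \<Rightarrow> bool stream measure" where
  "points p = stream_space (measure_pmf (bernoulli_pmf p))"

definition server_score :: "bool stream \<Rightarrow> nat \<Rightarrow> nat" where
  "server_score \<omega> n = card {i. i < n \<and> \<omega> !! i}"

definition receiver_score :: "bool stream \<Rightarrow> nat \<Rightarrow> nat" where
  "receiver_score \<omega> n = card {i. i < n \<and> \<not> \<omega> !! i}"

text \<open>A contest is given by a rule \<open>W\<close>, where \<open>W a b\<close> says that a player having \<open>a\<close> points against
  \<open>b\<close> points of the opponent has won. It stops the first time the rule holds for either player.\<close>

definition server_wins :: "(nat \<Rightarrow> nat \<Rightarrow> bool) \<Rightarrow> bool stream \<Rightarrow> bool" where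
  "server_wins W \<omega> \<longleftrightarrow>
     (\<exists>n. W (server_score \<omega> n) (receiver_score \<omega> n) \<and>
       (\<forall>m<n. \<not> W (server_score \<omega> m) (receiver_score \<omega> m) \<and>
              \<not> W (receiver_score \<omega> m) (server_score \<omega> m)))"

definition game_rule :: "nat \<Rightarrow> nat \<Rightarrow> bool" where
  "game_rule a b \<longleftrightarrow> a \<ge> 4 \<and> a \<ge> b + 2"

text \<open>In the tie-breaker, points are counted from the tied score at which it starts.\<close>

definition tiebreak_rule :: "nat \<Rightarrow> nat \<Rightarrow> bool" where
  "tiebreak_rule a b \<longleftrightarrow> a \<ge> b + 2"

definition theta_G :: "real \<Rightarrow> real" where
  "theta_G p = \<P>(\<omega> in points p. server_wins game_rule \<omega>)"

definition theta_GT :: "real \<Rightarrow> real" where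
  "theta_GT p = \<P>(\<omega> in points p. server_wins tiebreak_rule \<omega>)"

end

theory Submission imports Defs begin

text \<open>
  Let the contest start from an arbitrary score \<open>(a, b)\<close> and let \<open>win_prob W p a b\<close> be the
  probability that the server wins from there. Since the points that follow the first one are
  distributed like the whole stream, conditioning on the first point gives the recurrence
  \<open>win_prob W p a b = p * win_prob W p (a + 1) b + (1 - p) * win_prob W p a (b + 1)\<close>
  at every score where nobody has won (\<open>win_prob_step\<close>), while the probability is 1 or 0 as
  soon as somebody has.

  For the game, unfolding the recurrence from \<open>(0, 0)\<close> reaches the boundary scores
  \<open>(4, b)\<close> and \<open>(a, 4)\<close> with \<open>a, b \<le> 2\<close>, or else \<open>(3, 3)\<close>. From \<open>(3, 3)\<close> on, the condition of
  having at least 4 points follows from a lead of 2, so what remains is the tie-breaker. Summing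
  over the paths yields the formula for \<open>theta_G\<close>.

  For the tie-breaker, only the difference of the scores matters, so \<open>(1, 1)\<close> is as good as
  \<open>(0, 0)\<close> and two steps of the recurrence give \<open>t = p\<^sup>2 + 2 * p * (1 - p) * t\<close> for
  \<open>t = theta_GT p\<close>. This linear equation has a unique solution, as
  \<open>1 - 2 * p * (1 - p) = p\<^sup>2 + (1 - p)\<^sup>2 > 0\<close>; hence \<open>theta_GT p = p\<^sup>2 / (p\<^sup>2 + (1 - p)\<^sup>2)\<close>
  and \<open>theta_GT p + theta_GT (1 - p) = 1\<close>. With the formula for \<open>theta_G\<close>, the
  symmetry of the game becomes a polynomial identity.
\<close>

section \<open>Contests started from an arbitrary score\<close>

definition server_wins_from :: "(nat \<Rightarrow> nat \<Rightarrow> bool) \<Rightarrow> nat \<Rightarrow> nat \<Rightarrow> bool stream \<Rightarrow> bool" where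
  "server_wins_from W a b \<omega> \<longleftrightarrow>
     (\<exists>n. W (a + server_score \<omega> n) (b + receiver_score \<omega> n) \<and>
       (\<forall>m<n. \<not> W (a + server_score \<omega> m) (b + receiver_score \<omega> m) \<and>
              \<not> W (b + receiver_score \<omega> m) (a + server_score \<omega> m)))"

definition win_prob :: "(nat \<Rightarrow> nat \<Rightarrow> bool) \<Rightarrow> real \<Rightarrow> nat \<Rightarrow> nat \<Rightarrow> real" where
  "win_prob W p a b = \<P>(\<omega> in points p. server_wins_from W a b \<omega>)"

lemma server_wins_eq_from: "server_wins W = server_wins_from W 0 0"
  by (simp add: fun_eq_iff server_wins_def server_wins_from_def)

lemma score_0 [simp]: "server_score \<omega> 0 = 0" "receiver_score \<omega> 0 = 0"
  by (simp_all add: server_score_def receiver_score_def)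

lemma card_less_Suc_shift:
  "card {i. i < Suc n \<and> P i} = of_bool (P 0) + card {i. i < n \<and> P (Suc i)}"
proof -
  have "{i. i < Suc n \<and> P i} = {i. i = 0 \<and> P 0} \<union> Suc ` {i. i < n \<and> P (Suc i)}"
    by (auto simp: image_iff less_Suc_eq_0_disj)
  also have "card \<dots> = card {i::nat. i = 0 \<and> P 0} + card (Suc ` {i. i < n \<and> P (Suc i)})"
    by (intro card_Un_disjoint) auto
  also have "card {i::nat. i = 0 \<and> P 0} = of_bool (P 0)"
    by (cases "P 0") auto
  finally show ?thesis
    by (simp add: card_image)
qed

lemma score_SCons [simp]:
  "server_score (x ## \<omega>) (Suc n) = of_bool x + server_score \<omega> n"
  "receiver_score (x ## \<omega>) (Suc n) = of_bool (\<not> x) + receiver_score \<omega> n"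
  unfolding server_score_def receiver_score_def by (simp_all add: card_less_Suc_shift)

lemma server_wins_from_SCons:
  "server_wins_from W a b (x ## \<omega>) \<longleftrightarrow>
     W a b \<or> \<not> W b a \<and>
       (if x then server_wins_from W (Suc a) b \<omega> else server_wins_from W a (Suc b) \<omega>)"
proof -
  have ex_nat: "(\<exists>n. P n) \<longleftrightarrow> P 0 \<or> (\<exists>n. P (Suc n))" for P :: "nat \<Rightarrow> bool"
    by (metis not0_implies_Suc)
  show ?thesis
    unfolding server_wins_from_def
    by (subst ex_nat) (cases x; auto simp: All_less_Suc2)
qed

text \<open>Scores only grow, so a contest depends on its rule only at scores above the current one.
  This is what turns deuce into the start of a tie-breaker, and lets a tied tie-breaker be
  restarted from \<open>(0, 0)\<close>.\<close>

lemma server_wins_from_cong: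
  assumes "\<And>x y. W (a + x) (b + y) = W' (c + x) (d + y)"
    and "\<And>x y. W (b + y) (a + x) = W' (d + y) (c + x)"
  shows "server_wins_from W a b = server_wins_from W' c d"
  by (simp add: fun_eq_iff server_wins_from_def assms)

section \<open>Conditioning on the first point\<close>

lemma measurable_server_wins_from [measurable]:
  "Measurable.pred (stream_space (measure_pmf P)) (server_wins_from W a b)"
proof -
  let ?M = "stream_space (measure_pmf P)"
  have [measurable]: "(\<lambda>\<omega>. \<omega> !! i) \<in> measurable ?M (count_space UNIV)" for i
    using measurable_snth[of i "measure_pmf P"]
    by (simp cong: measurable_cong_sets)
  have [measurable]: "(\<lambda>\<omega>. server_score \<omega> n) \<in> measurable ?M (count_space UNIV)"
    "(\<lambda>\<omega>. receiver_score \<omega> n) \<in> measurable ?M (count_space UNIV)" for n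
    unfolding server_score_def receiver_score_def by measurable
  show ?thesis
    unfolding server_wins_from_def[abs_def] by measurable
qed

text \<open>The stream after the first point is independent of it and has the law of the whole stream.
  It therefore decides the contest that starts from the score which the first point produces.\<close>

lemma win_prob_step:
  assumes "p \<in> {0..1}" "\<not> W a b" "\<not> W b a"
  shows "win_prob W p a b = p * win_prob W p (Suc a) b + (1 - p) * win_prob W p a (Suc b)"
proof -
  let ?B = "measure_pmf (bernoulli_pmf p)"
  have nonneg: "win_prob W p c d \<ge> 0" for c d
    by (simp add: win_prob_def)
  have "ennreal (win_prob W p a b) =
      (\<integral>\<^sup>+x. \<P>(\<omega> in stream_space ?B. server_wins_from W a b (x ## \<omega>)) \<partial>?B)"
    unfolding win_prob_def points_def
    by (rule prob_space.prob_stream_space[OF measure_pmf.prob_space_axioms]) measurable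
  also have "\<dots> = ennreal (win_prob W p (Suc a) b) * ennreal p +
      ennreal (win_prob W p a (Suc b)) * ennreal (1 - p)"
    using assms by (simp add: server_wins_from_SCons win_prob_def points_def)
  also have "\<dots> = ennreal (p * win_prob W p (Suc a) b + (1 - p) * win_prob W p a (Suc b))"
    using assms nonneg by (simp add: ennreal_plus ennreal_mult mult.commute)
  finally show ?thesis
    using assms nonneg by (subst (asm) ennreal_inj) auto
qed

lemma prob_space_points: "prob_space (points p)"
  unfolding points_def by (rule prob_space.prob_space_stream_space[OF measure_pmf.prob_space_axioms])

lemma win_prob_won: "W a b \<Longrightarrow> win_prob W p a b = 1"
proof -
  assume "W a b"
  then have "server_wins_from W a b \<omega>" for \<omega>
    by (cases \<omega>) (simp add: server_wins_from_SCons)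
  then show ?thesis
    by (simp add: win_prob_def prob_space.prob_space[OF prob_space_points])
qed

lemma win_prob_lost:
  assumes "\<not> W a b" "W b a"
  shows "win_prob W p a b = 0"
proof -
  have "\<not> server_wins_from W a b \<omega>" for \<omega>
    using assms by (cases \<omega>) (simp add: server_wins_from_SCons)
  then show ?thesis
    by (simp add: win_prob_def)
qed

section \<open>The tie-breaker\<close>

lemma theta_GT_eq_win_prob: "theta_GT p = win_prob tiebreak_rule p 0 0"
  by (simp add: theta_GT_def win_prob_def server_wins_eq_from)

text \<open>After two points the server has won, the receiver has won, or the score is tied again and
  the tie-breaker starts afresh.\<close>

lemma theta_GT_fixpoint:
  assumes p: "p \<in> {0..1}"
  shows "theta_GT p = p\<^sup>2 + 2 * p * (1 - p) * theta_GT p"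
proof -
  let ?w = "win_prob tiebreak_rule p"
  have "server_wins_from tiebreak_rule 1 1 = server_wins_from tiebreak_rule 0 0"
    by (rule server_wins_from_cong) (auto simp: tiebreak_rule_def)
  then have tied: "?w 1 1 = theta_GT p"
    by (simp add: theta_GT_eq_win_prob win_prob_def)
  have "?w 2 0 = 1" "?w 0 2 = 0"
    by (auto intro!: win_prob_won win_prob_lost simp: tiebreak_rule_def)
  moreover have "?w 0 0 = p * ?w 1 0 + (1 - p) * ?w 0 1"
    using win_prob_step[OF p, of tiebreak_rule 0 0] by (simp add: tiebreak_rule_def)
  moreover have "?w 1 0 = p * ?w 2 0 + (1 - p) * ?w 1 1"
    using win_prob_step[OF p, of tiebreak_rule 1 0]
    by (simp add: tiebreak_rule_def numeral_2_eq_2)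
  moreover have "?w 0 1 = p * ?w 1 1 + (1 - p) * ?w 0 2"
    using win_prob_step[OF p, of tiebreak_rule 0 1]
    by (simp add: tiebreak_rule_def numeral_2_eq_2)
  ultimately show ?thesis
    using tied unfolding theta_GT_eq_win_prob by algebra
qed

lemma theta_GT_formula:
  assumes "p \<in> {0..1}"
  shows "theta_GT p = p\<^sup>2 / (p\<^sup>2 + (1 - p)\<^sup>2)"
proof -
  have "p\<^sup>2 + (1 - p)\<^sup>2 \<noteq> 0"
    by (simp add: sum_power2_eq_zero_iff)
  moreover have "theta_GT p * (p\<^sup>2 + (1 - p)\<^sup>2) = p\<^sup>2"
    using theta_GT_fixpoint[OF assms] by (simp add: power2_eq_square algebra_simps)
  ultimately show ?thesis
    by (simp add: eq_divide_eq)
qed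

lemma theta_GT_flip:
  assumes "p \<in> {0..1}"
  shows "theta_GT (1 - p) = 1 - theta_GT p"
proof -
  have "p\<^sup>2 + (1 - p)\<^sup>2 \<noteq> 0"
    by (simp add: sum_power2_eq_zero_iff)
  then show ?thesis
    using assms by (simp add: theta_GT_formula divide_simps)
qed

section \<open>The game\<close>

lemma win_prob_deuce: "win_prob game_rule p 3 3 = theta_GT p"
proof -
  have "server_wins_from game_rule 3 3 = server_wins_from tiebreak_rule 0 0"
    by (rule server_wins_from_cong) (auto simp: game_rule_def tiebreak_rule_def)
  then show ?thesis
    by (simp add: theta_GT_eq_win_prob win_prob_def)
qed

lemma theta_G_formula:
  assumes p: "p \<in> {0..1}" and q: "q = 1 - p"
  shows "theta_G p = p ^ 4 + 4 * p ^ 4 * q + 10 * p ^ 4 * q\<^sup>2 + 20 * p ^ 3 * q ^ 3 * theta_GT p"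
proof -
  let ?w = "win_prob game_rule p"
  have won: "?w 4 b = 1" if "b \<le> 2" for b
    using that by (intro win_prob_won) (simp add: game_rule_def)
  have lost: "?w a 4 = 0" if "a \<le> 2" for a
    using that by (intro win_prob_lost) (simp_all add: game_rule_def)
  \<comment> \<open>The successors are variables, so that the equation can be matched against numerals.\<close>
  have step: "?w a b = p * ?w a' b + q * ?w a b'"
    if "a' = a + 1" "b' = b + 1" "a \<le> 3" "b \<le> 3" for a b a' b'
    using win_prob_step[OF p, of game_rule a b] that q by (simp add: game_rule_def)
  have steps:
    "?w 3 2 = p * ?w 4 2 + q * ?w 3 3" "?w 3 1 = p * ?w 4 1 + q * ?w 3 2"
    "?w 3 0 = p * ?w 4 0 + q * ?w 3 1" "?w 2 3 = p * ?w 3 3 + q * ?w 2 4"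
    "?w 2 2 = p * ?w 3 2 + q * ?w 2 3" "?w 2 1 = p * ?w 3 1 + q * ?w 2 2"
    "?w 2 0 = p * ?w 3 0 + q * ?w 2 1" "?w 1 3 = p * ?w 2 3 + q * ?w 1 4"
    "?w 1 2 = p * ?w 2 2 + q * ?w 1 3" "?w 1 1 = p * ?w 2 1 + q * ?w 1 2"
    "?w 1 0 = p * ?w 2 0 + q * ?w 1 1" "?w 0 3 = p * ?w 1 3 + q * ?w 0 4"
    "?w 0 2 = p * ?w 1 2 + q * ?w 0 3" "?w 0 1 = p * ?w 1 1 + q * ?w 0 2"
    "?w 0 0 = p * ?w 1 0 + q * ?w 0 1"
    by (rule step; simp)+
  have ends: "?w 4 0 = 1" "?w 4 1 = 1" "?w 4 2 = 1" "?w 0 4 = 0" "?w 1 4 = 0" "?w 2 4 = 0"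
    by (rule won lost; simp)+
  have "theta_G p = ?w 0 0"
    by (simp add: theta_G_def win_prob_def server_wins_eq_from)
  also have "\<dots> = p ^ 4 + 4 * p ^ 4 * q + 10 * p ^ 4 * q\<^sup>2 + 20 * p ^ 3 * q ^ 3 * theta_GT p"
    unfolding steps ends win_prob_deuce
    by (simp add: eval_nat_numeral algebra_simps)
  finally show ?thesis .
qed

theorem theorem2p3:
  fixes p q :: real
  assumes "p \<in> {0..1}" and "q = 1 - p"
  shows "theta_G p = p ^ 4 + 4 * p ^ 4 * q + 10 * p ^ 4 * q\<^sup>2 + 20 * p ^ 3 * q ^ 3 * theta_GT p
    \<and> theta_G (1 - p) = 1 - theta_G p"
proof
  show game: "theta_G p =
      p ^ 4 + 4 * p ^ 4 * q + 10 * p ^ 4 * q\<^sup>2 + 20 * p ^ 3 * q ^ 3 * theta_GT p"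
    using assms by (rule theta_G_formula)
  have "theta_G q =
      q ^ 4 + 4 * q ^ 4 * p + 10 * q ^ 4 * p\<^sup>2 + 20 * q ^ 3 * p ^ 3 * theta_GT q"
    using assms by (intro theta_G_formula) auto
  moreover have "theta_GT q = 1 - theta_GT p"
    using assms theta_GT_flip by simp
  ultimately have "theta_G q = 1 - theta_G p"
    using game \<open>q = 1 - p\<close> by algebra
  then show "theta_G (1 - p) = 1 - theta_G p"
    using \<open>q = 1 - p\<close> by simp
qed

end
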